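(* Let the integers $F(n,k)$, for $n\ge 0$ and $0\le k\le n$, be defined by $F(0,0)=1$, $F(n,n)=0$ for $n>0$, and, for $n>0$ and $0\le k<n$, $$F(n,k)=\sum_{j=0}^{k}\binom{k-j+2}{2}F(n-1,j).$$ For integers $p\ge 1$, $q\ge 0$, $n\ge 0$ let $\mathsf{A}_n(p,q)=\frac{q}{pn+q}\binom{pn+q}{n}$ (Fuss–Catalan numbers). Then for every $n>0$: (i) $\sum_{k=0}^{n}F(n,k)=\mathsf{A}_n(4,1)=\frac{1}{4n+1}\binom{4n+1}{n}$; (ii) $\sum_{k=0}^{n}F(n,k)\binom{n-k+3}{3}=\mathsf{A}_n(4,4)=\frac{4}{4n+4}\binom{4n+4}{n}$; (iii) $F(n,n-1)=\mathsf{A}_{n-1}(4,3)=\frac{3}{4n-1}\binom{4n-1}{n-1}$. *)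

theory Defs
  imports Complex_Main
begin

text \<open>Only the entries with \<open>k \<le> n\<close> are meaningful; \<open>triF n k = 0\<close> for \<open>k > n\<close> merely makes the
  function total, and no entry with \<open>k > n\<close> enters the recursion for an entry with \<open>k \<le> n\<close>.\<close>

fun triF :: "nat \<Rightarrow> nat \<Rightarrow> int" where
  "triF 0 k = (if k = 0 then 1 else 0)"
| "triF (Suc n) k =
     (if k < Suc n then \<Sum>j = 0..k. int ((k - j + 2) choose 2) * triF n j else 0)"

text \<open>The intended range is \<open>p \<ge> 1\<close>, \<open>q \<ge> 0\<close>.\<close>

definition fuss_catalan :: "nat \<Rightarrow> nat \<Rightarrow> nat \<Rightarrow> real" where
  "fuss_catalan p q n = real q / real (p * n + q) * real ((p * n + q) choose n)"

end

theory Submission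
  imports Defs
begin

text \<open>
  The weighted ballot numbers \<open>g(m,k) = (m - s k) / (m + k) * (m + k choose k)\<close> satisfy the Pascal
  rule \<open>g(m+1,k+1) = g(m+1,k) + g(m,k+1)\<close>, so weighting a row by \<open>(k - j + r) choose r\<close> amounts to
  \<open>r + 1\<close> successive partial summations and turns row \<open>m\<close> into row \<open>m + r + 1\<close>. For \<open>s = 3\<close> and
  \<open>r = 2\<close> this is the recursion of the triangle, whence \<open>F(n,k) = g(3n,k)\<close>; the forced zeros \<open>F(n,n)\<close>
  agree with the factor \<open>m - 3 k\<close>. The two sums are then the cases \<open>r = 0\<close> and \<open>r = 3\<close>, and
  \<open>g(s k + q, k)\<close> is the Fuss--Catalan number \<open>A\<^sub>k(s + 1, q)\<close>.
\<close>

text \<open>A division-free form of the quotient: it keeps the values integral, lets the Pascal rule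
  follow from that of the binomials, and gives the apex value 1 at \<open>m = k = 0\<close>, where
  the quotient is 0/0.\<close>

fun ballot :: "nat \<Rightarrow> nat \<Rightarrow> nat \<Rightarrow> int" where
  "ballot s m 0 = 1"
| "ballot s m (Suc k) = int ((m + k) choose Suc k) - int s * int ((m + k) choose k)"

lemma ballot_Suc_Suc: "ballot s (Suc m) (Suc k) = ballot s (Suc m) k + ballot s m (Suc k)"
  by (cases k) (auto simp: algebra_simps)

text \<open>For positive \<open>k\<close>, absorption makes the two binomials in the definition the
  fractions m/(m+k) and k/(m+k) of \<open>(m + k) choose k\<close>.\<close>

lemma ballot_closed_form:
  "int (m + k) * ballot s m k = (int m - int s * int k) * int ((m + k) choose k)"
proof (cases k)
  case (Suc l)
  have "int (Suc l) * int ((m + l) choose Suc l) = int m * int ((m + l) choose l)"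
    by (metis Suc_times_binomial_add add.commute add_diff_cancel_right' binomial_absorb_comp
        binomial_absorption of_nat_mult)
  then have 1: "(int m + int (Suc l)) * int ((m + l) choose Suc l)
      = int m * int ((m + Suc l) choose Suc l)"
    by (simp add: algebra_simps)
  have 2: "int (m + Suc l) * int ((m + l) choose l)
      = int (Suc l) * int ((m + Suc l) choose Suc l)"
    by (metis Suc_times_binomial_eq add_Suc_right mult.commute of_nat_mult)
  have "int (m + k) * ballot s m k
      = (int m + int (Suc l)) * int ((m + l) choose Suc l)
        - int s * (int (m + Suc l) * int ((m + l) choose l))"
    by (simp add: Suc algebra_simps)
  also have "\<dots> = (int m - int s * int k) * int ((m + k) choose k)"
    unfolding 1 2 by (simp add: Suc algebra_simps)
  finally show ?thesis .
qed simp

text \<open>In row \<open>s * k + q\<close> the factor m - s k of the closed form collapses to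
  \<open>q\<close>.\<close>

lemma fuss_catalan_eq_ballot:
  assumes "q > 0"
  shows "fuss_catalan (Suc s) q k = real_of_int (ballot s (s * k + q) k)"
proof -
  let ?N = "Suc s * k + q"
  have N: "s * k + q + k = ?N" by simp
  have "int ?N * ballot s (s * k + q) k = int q * int (?N choose k)"
    using ballot_closed_form[of "s * k + q" k s] unfolding N by simp
  then have "real ?N * real_of_int (ballot s (s * k + q) k) = real q * real (?N choose k)"
    by (metis of_int_mult of_int_of_nat_eq)
  moreover have "real ?N > 0" using assms by (simp only: of_nat_0_less_iff add_pos_nonneg add_nonneg_pos zero_le)
  ultimately show ?thesis
    unfolding fuss_catalan_def by (simp add: field_simps)
qed

lemma sum_ballot: "(\<Sum>j\<le>k. ballot s m j) = ballot s (Suc m) k"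
  by (induction k) (auto simp: ballot_Suc_Suc simp del: ballot.simps(2))

lemma sum_choose_ballot:
  "(\<Sum>j\<le>k. int ((k - j + r) choose r) * ballot s m j) = ballot s (m + r + 1) k"
proof (induction r arbitrary: k)
  case 0
  then show ?case by (simp add: sum_ballot)
next
  case r: (Suc r)
  show ?case
  proof (induction k)
    case (Suc k)
    \<comment> \<open>Pascal's rule splits each weight in two. In the first sum the term j = k + 1
      drops out, its weight being \<open>r choose Suc r\<close>, so the inner induction applies to
      it; the outer one evaluates the second sum.\<close>
    have "(\<Sum>j\<le>Suc k. int ((Suc k - j + Suc r) choose Suc r) * ballot s m j)
        = (\<Sum>j\<le>k. int ((k - j + Suc r) choose Suc r) * ballot s m j)
          + (\<Sum>j\<le>Suc k. int ((Suc k - j + r) choose r) * ballot s m j)"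
      by (simp add: sum.distrib[symmetric] Suc_diff_le algebra_simps del: ballot.simps)
    then show ?case
      using Suc r[of "Suc k"] by (simp add: ballot_Suc_Suc del: ballot.simps)
  qed simp
qed

lemma triF_eq_ballot: "k \<le> n \<Longrightarrow> triF n k = ballot 3 (3 * n) k"
proof (induction n arbitrary: k)
  case (Suc n)
  show ?case
  proof (cases "k = Suc n")
    case True
    have "ballot 3 (3 * Suc n) (Suc n) = 0"
      using ballot_closed_form[of "3 * Suc n" "Suc n" 3] by (simp del: ballot.simps binomial_Suc_Suc)
    then show ?thesis using True by simp
  next
    case False
    \<comment> \<open>Since now k \<le> n, every j in the recursion lies in the meaningful part of
      row \<open>n\<close>, where the induction hypothesis holds.\<close>
    then have "triF (Suc n) k = (\<Sum>j\<le>k. int ((k - j + 2) choose 2) * ballot 3 (3 * n) j)"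
      using Suc by (auto simp: atMost_atLeast0 intro!: sum.cong)
    then show ?thesis
      using sum_choose_ballot[of k 2 3 "3 * n"]
      by (simp add: numeral_eq_Suc del: triF.simps ballot.simps binomial_Suc_Suc)
  qed
qed simp

theorem theorem3:
  fixes n :: nat
  assumes "n > 0"
  shows "(real_of_int (\<Sum>k = 0..n. triF n k) = fuss_catalan 4 1 n
          \<and> fuss_catalan 4 1 n = 1 / (4 * real n + 1) * real ((4 * n + 1) choose n))
       \<and> (real_of_int (\<Sum>k = 0..n. triF n k * int ((n - k + 3) choose 3)) = fuss_catalan 4 4 n
          \<and> fuss_catalan 4 4 n = 4 / (4 * real n + 4) * real ((4 * n + 4) choose n))
       \<and> (real_of_int (triF n (n - 1)) = fuss_catalan 4 3 (n - 1)
          \<and> fuss_catalan 4 3 (n - 1) = 3 / (4 * real n - 1) * real ((4 * n - 1) choose (n - 1)))"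
proof (intro conjI)
  have fc: "fuss_catalan 4 q k = real_of_int (ballot 3 (3 * k + q) k)" if "q > 0" for q k
    using fuss_catalan_eq_ballot[OF that, of 3 k] by simp
  have "(\<Sum>k = 0..n. triF n k) = (\<Sum>k\<le>n. ballot 3 (3 * n) k)"
    unfolding atMost_atLeast0 by (intro sum.cong) (auto simp: triF_eq_ballot)
  then show "real_of_int (\<Sum>k = 0..n. triF n k) = fuss_catalan 4 1 n"
    by (simp add: fc sum_ballot)
  have "(\<Sum>k = 0..n. triF n k * int ((n - k + 3) choose 3))
      = (\<Sum>k\<le>n. int ((n - k + 3) choose 3) * ballot 3 (3 * n) k)"
    unfolding atMost_atLeast0 by (intro sum.cong) (auto simp: triF_eq_ballot)
  \<comment> \<open>Weight r = 3 raises the row by 4, which is where q = 4 comes from.\<close>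
  also have "\<dots> = ballot 3 (3 * n + 4) n"
    using sum_choose_ballot[of n 3 3 "3 * n"] by (simp add: algebra_simps)
  finally show "real_of_int (\<Sum>k = 0..n. triF n k * int ((n - k + 3) choose 3)) = fuss_catalan 4 4 n"
    by (simp add: fc)
  obtain m where n: "n = Suc m" using assms gr0_implies_Suc by blast
  \<comment> \<open>Relative to column n - 1, row 3 n is row 3 (n - 1) + 3, so q = 3.\<close>
  have "triF n (n - 1) = ballot 3 (3 * (n - 1) + 3) (n - 1)"
    using triF_eq_ballot[of m "Suc m"] by (simp add: n add.commute del: triF.simps)
  then show "real_of_int (triF n (n - 1)) = fuss_catalan 4 3 (n - 1)"
    by (simp add: fc)
  have "4 * (n - 1) + 3 = 4 * n - 1" "real (4 * n - 1) = 4 * real n - 1"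
    by (simp_all add: n)
  then show "fuss_catalan 4 3 (n - 1) = 3 / (4 * real n - 1) * real ((4 * n - 1) choose (n - 1))"
    by (simp add: fuss_catalan_def)
qed (simp_all add: fuss_catalan_def add.commute)

end
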